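(* Let $n\ge1$ and $K\in\mathbb{N}$. For each multiset $\psi\in\mathcal{M}[K](\mathbf{n})$, the dual basis function $\mathfrak{d}_\psi\in P_K(\Delta^n)$ is a continuous signed probability density on $\Delta^n$, that is, $$\int_{\vec r\in\Delta^n}\mathfrak{d}_\psi(\vec r)\,d\vec r=1.$$
   Context: For $n\ge1$ let $\mathbf{n}=\{0,\dots,n-1\}$. A multiset on $\mathbf{n}$ is a function $\varphi:\mathbf{n}\to\mathbb{N}$; its size is $\|\varphi\|=\sum_i\varphi(i)$, $\mathcal{M}[K](\mathbf{n})$ is the set of multisets of size $K$, and $\varphi!=\prod_i\varphi(i)!$. Simplex: $\Delta^n=\{\vec r\in\mathbb{R}_{\ge0}^n\mid\sum_i r_i=1\}$. Integrals over $\Delta^n$ are with respect to Lebesgue measure in the coordinates $(r_0,\dots,r_{n-2})$ (a point mass $1$ if $n=1$), so that $\int_{\Delta^n}\prod_i r_i^{\varphi(i)}\,d\vec r=\frac{\varphi!}{(\|\varphi\|+n-1)!}$ for every multiset $\varphi$. For $\varphi\in\mathcal{M}[K](\mathbf{n})$ let $\mathfrak{m}_\varphi:\Delta^n\to\mathbb{R}$, $\mathfrak{m}_\varphi(\vec r)=\frac{K!}{\varphi!}\prod_i r_i^{\varphi(i)}$. Let $P_K(\Delta^n)$ be the real vector space of functions on $\Delta^n$ spanned by the $\mathfrak{m}_\varphi$, $\varphi\in\mathcal{M}[K](\mathbf{n})$ (these form a basis), with inner product $\langle f,g\rangle=\int_{\Delta^n}f(\vec r)g(\vec r)\,d\vec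 r$. The dual multinomials $(\mathfrak{d}_\psi)_{\psi\in\mathcal{M}[K](\mathbf{n})}$ are the unique elements of $P_K(\Delta^n)$ with $\langle\mathfrak{m}_\varphi,\mathfrak{d}_\psi\rangle=\delta_{\varphi,\psi}$ for all $\varphi,\psi\in\mathcal{M}[K](\mathbf{n})$. A signed continuous probability distribution on $\Delta^n$ is given by a density $f:\Delta^n\to\mathbb{R}$ (possibly taking negative values) with $\int_{\Delta^n}f(\vec r)\,d\vec r=1$. *)

theory Defs
  imports "HOL-Analysis.Analysis" "HOL-Library.Multiset"
begin

definition multisets :: "nat \<Rightarrow> nat \<Rightarrow> nat multiset set" where
  "multisets n K = {\<phi>. set_mset \<phi> \<subseteq> {..<n} \<and> size \<phi> = K}"

definition mset_fact :: "nat \<Rightarrow> nat multiset \<Rightarrow> real" where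
  "mset_fact n \<phi> = (\<Prod>i<n. fact (count \<phi> i))"

text \<open>Points of $\mathbb{R}^n$ are functions on the index set $\{0,\dots,n-1\}$, extended by
  \<^term>\<open>undefined\<close> outside it; functions on the simplex are treated in the same way, so that
  equality of two such functions is equality at every point of the simplex.\<close>

definition std_simplex :: "nat \<Rightarrow> (nat \<Rightarrow> real) set" where
  "std_simplex n = {r \<in> {..<n} \<rightarrow>\<^sub>E {0..}. (\<Sum>i<n. r i) = 1}"

text \<open>The chart $(r_0,\dots,r_{n-2}) \mapsto (r_0,\dots,r_{n-2},1-\sum_{i<n-1}r_i)$ of the
  hyperplane $\sum_i r_i = 1$, and the measure on that hyperplane that is Lebesgue measure in
  these coordinates. For $n = 1$ the product measure is over the empty index set, hence the unit
  point mass.\<close>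

definition last_coord_chart :: "nat \<Rightarrow> (nat \<Rightarrow> real) \<Rightarrow> (nat \<Rightarrow> real)" where
  "last_coord_chart n s = (\<lambda>i\<in>{..<n}. if i < n - 1 then s i else 1 - (\<Sum>j<n - 1. s j))"

definition hyperplane_measure :: "nat \<Rightarrow> (nat \<Rightarrow> real) measure" where
  "hyperplane_measure n =
     distr (Pi\<^sub>M {..<n - 1} (\<lambda>_. lborel)) (Pi\<^sub>M {..<n} (\<lambda>_. lborel)) (last_coord_chart n)"

text \<open>Measurability of the chart and of the simplex, without which \<^const>\<open>distr\<close> and set
  integrals would be degenerate.\<close>

lemma last_coord_chart_measurable:
  "last_coord_chart n \<in> Pi\<^sub>M {..<n - 1} (\<lambda>_. lborel) \<rightarrow>\<^sub>M Pi\<^sub>M {..<n} (\<lambda>_. lborel)"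
  unfolding last_coord_chart_def
proof (rule measurable_restrict)
  fix i assume "i \<in> {..<n}"
  show "(\<lambda>s. if i < n - 1 then s i else 1 - (\<Sum>j<n - 1. s j))
      \<in> Pi\<^sub>M {..<n - 1} (\<lambda>_. lborel) \<rightarrow>\<^sub>M (lborel :: real measure)"
    by (cases "i < n - 1") (auto intro!: borel_measurable_diff borel_measurable_sum)
qed

lemma std_simplex_sets: "std_simplex n \<in> sets (hyperplane_measure n)"
proof -
  have eq: "std_simplex n = {r \<in> space (Pi\<^sub>M {..<n} (\<lambda>_. lborel)).
      (\<forall>i\<in>{..<n}. 0 \<le> r i) \<and> (\<Sum>i<n. r i) = 1}"
    by (auto simp: std_simplex_def space_PiM PiE_def Pi_def)
  have "{r \<in> space (Pi\<^sub>M {..<n} (\<lambda>_. lborel)).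
      (\<forall>i\<in>{..<n}. 0 \<le> (r i :: real)) \<and> (\<Sum>i<n. r i) = 1} \<in> sets (Pi\<^sub>M {..<n} (\<lambda>_. lborel))"
    by measurable
  then show ?thesis
    unfolding eq hyperplane_measure_def by simp
qed

definition simplex_integral :: "nat \<Rightarrow> ((nat \<Rightarrow> real) \<Rightarrow> real) \<Rightarrow> real" where
  "simplex_integral n f = (LINT r:std_simplex n|hyperplane_measure n. f r)"

definition multinomial_fun :: "nat \<Rightarrow> nat \<Rightarrow> nat multiset \<Rightarrow> (nat \<Rightarrow> real) \<Rightarrow> real" where
  "multinomial_fun n K \<phi> =
     (\<lambda>r\<in>std_simplex n. fact K / mset_fact n \<phi> * (\<Prod>i<n. r i ^ count \<phi> i))"

definition multinomial_space :: "nat \<Rightarrow> nat \<Rightarrow> ((nat \<Rightarrow> real) \<Rightarrow> real) set" where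
  "multinomial_space n K =
     range (\<lambda>c. \<lambda>r\<in>std_simplex n. \<Sum>\<phi>\<in>multisets n K. c \<phi> * multinomial_fun n K \<phi> r)"

definition simplex_inner ::
    "nat \<Rightarrow> ((nat \<Rightarrow> real) \<Rightarrow> real) \<Rightarrow> ((nat \<Rightarrow> real) \<Rightarrow> real) \<Rightarrow> real" where
  "simplex_inner n f g = simplex_integral n (\<lambda>r. f r * g r)"

definition dual_multinomial :: "nat \<Rightarrow> nat \<Rightarrow> nat multiset \<Rightarrow> (nat \<Rightarrow> real) \<Rightarrow> real" where
  "dual_multinomial n K \<psi> =
     (THE d. d \<in> multinomial_space n K \<and>
        (\<forall>\<phi>\<in>multisets n K.
           simplex_inner n (multinomial_fun n K \<phi>) d = (if \<phi> = \<psi> then 1 else 0)))"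

definition signed_density :: "nat \<Rightarrow> ((nat \<Rightarrow> real) \<Rightarrow> real) \<Rightarrow> bool" where
  "signed_density n f \<longleftrightarrow>
     set_integrable (hyperplane_measure n) (std_simplex n) f \<and> simplex_integral n f = 1"

end

theory Submission
  imports Defs "HOL-Computational_Algebra.Polynomial"
begin

text \<open>The multinomials of size \<open>K\<close> sum to \<open>(\<Sum>i<n. r i) ^ K\<close>, which is the constant 1 on the
  simplex. Hence the integral of a dual multinomial is the sum of its inner products with all
  multinomials, only one of which is 1 while the others vanish. That the dual basis exists and is
  unique follows from positive definiteness of the inner product: if the square of a linear
  combination of multinomials has integral 0, then the combination vanishes almost everywhere, so
  by continuity on the interior of the simplex, and its coefficients are 0 by linear
  independence.\<close>

subsection \<open>Anisotropic matrices\<close>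

text \<open>Anisotropy survives restriction to fewer indices, so induction on \<open>I\<close>
  applies: a vector killed by the old rows is added in the right amount to solve the new row. For
  the Gram matrix of the multinomials, anisotropy is positive definiteness, and solvability yields
  the dual functions.\<close>

lemma anisotropic_system_solvable:
  fixes G :: "'i \<Rightarrow> 'i \<Rightarrow> 'a::field" and b :: "'i \<Rightarrow> 'a"
  assumes "finite I"
    and "\<And>c. (\<Sum>i\<in>I. \<Sum>j\<in>I. c i * c j * G i j) = 0 \<Longrightarrow> \<forall>i\<in>I. c i = 0"
  shows "\<exists>c. \<forall>i\<in>I. (\<Sum>j\<in>I. G i j * c j) = b i"
  using assms
proof (induction I arbitrary: b rule: finite_induct)
  case empty
  then show ?case by simp
next
  case (insert x I)
  have aniso: "\<forall>i\<in>I. c i = 0" if c: "(\<Sum>i\<in>I. \<Sum>j\<in>I. c i * c j * G i j) = 0" for c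
  proof -
    \<comment> \<open>Extending \<open>c\<close> by 0 at \<open>x\<close> leaves the quadratic form
      unchanged, so anisotropy on \<open>insert x I\<close> carries over to
      \<open>I\<close>.\<close>
    define c' where "c' = c(x := 0)"
    have eq: "c' i = c i" if "i \<in> I" for i
      using that insert.hyps by (auto simp: c'_def)
    have "(\<Sum>j\<in>insert x I. c' i * c' j * G i j) = (\<Sum>j\<in>I. c' i * c j * G i j)" for i
      using insert.hyps by (simp add: eq) (simp add: c'_def)
    then have "(\<Sum>i\<in>insert x I. \<Sum>j\<in>insert x I. c' i * c' j * G i j)
        = (\<Sum>i\<in>insert x I. \<Sum>j\<in>I. c' i * c j * G i j)"
      by (rule sum.cong[OF refl])
    also have "\<dots> = (\<Sum>i\<in>I. \<Sum>j\<in>I. c i * c j * G i j)"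
      using insert.hyps by (simp add: eq) (simp add: c'_def)
    also note c
    finally have "\<forall>i\<in>insert x I. c' i = 0"
      by (rule insert.prems)
    then show ?thesis using eq by simp
  qed
  \<comment> \<open>With this right-hand side, putting the value 1 at \<open>x\<close> turns
    \<open>u\<close> into a vector \<open>w\<close> that every row in \<open>I\<close> sends to
    0.\<close>
  have "\<exists>u. \<forall>i\<in>I. (\<Sum>j\<in>I. G i j * u j) = - G i x"
    by (rule insert.IH) (rule aniso)
  then obtain u where u: "\<And>i. i \<in> I \<Longrightarrow> (\<Sum>j\<in>I. G i j * u j) = - G i x"
    by blast
  have "\<exists>v. \<forall>i\<in>I. (\<Sum>j\<in>I. G i j * v j) = b i"
    by (rule insert.IH) (rule aniso)
  then obtain v where v: "\<And>i. i \<in> I \<Longrightarrow> (\<Sum>j\<in>I. G i j * v j) = b i"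
    by blast
  define A where "A c i = (\<Sum>j\<in>insert x I. G i j * c j)" for c i
  have A_insert: "A c i = G i x * c x + (\<Sum>j\<in>I. G i j * c j)" for c i
    using insert.hyps by (simp add: A_def)
  have A_add_scale: "A (\<lambda>j. c j + t * c' j) i = A c i + t * A c' i" for c c' t i
    by (simp add: A_insert distrib_left sum.distrib sum_distrib_left mult_ac)
  \<comment> \<open>If all rows send \<open>c\<close> to 0, the quadratic form vanishes at
    \<open>c\<close>, so anisotropy applies. Since \<open>w x = 1\<close>, this excludes
    \<open>A w x = 0\<close> below.\<close>
  have A_nonzero: "c x = 0" if "\<And>i. i \<in> insert x I \<Longrightarrow> A c i = 0" for c
  proof -
    have "(\<Sum>i\<in>J. \<Sum>j\<in>J'. c i * c j * G i j) = (\<Sum>i\<in>J. c i * (\<Sum>j\<in>J'. G i j * c j))" for J J'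
      by (simp add: sum_distrib_left mult_ac)
    also have "(\<Sum>i\<in>insert x I. c i * (\<Sum>j\<in>insert x I. G i j * c j)) = 0"
      unfolding A_def[symmetric] using that by (intro sum.neutral) auto
    finally have "\<forall>i\<in>insert x I. c i = 0"
      by (rule insert.prems)
    then show ?thesis by (rule bspec) simp
  qed
  define w where "w = u(x := 1)"
  define v' where "v' = v(x := 0)"
  have sums: "(\<Sum>j\<in>I. G i j * w j) = (\<Sum>j\<in>I. G i j * u j)"
    "(\<Sum>j\<in>I. G i j * v' j) = (\<Sum>j\<in>I. G i j * v j)" for i
    using insert.hyps by (auto simp: w_def v'_def intro!: sum.cong)
  have w_orth: "A w i = 0" and v_sol: "A v' i = b i" if "i \<in> I" for i
    unfolding A_insert sums using u[OF that] v[OF that] by (simp_all add: w_def v'_def)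
  have "A w x \<noteq> 0"
  proof
    assume "A w x = 0"
    then have "w x = 0"
      using w_orth by (auto intro: A_nonzero[of w])
    then show False by (simp add: w_def)
  qed
  \<comment> \<open>Adding multiples of \<open>w\<close> keeps the rows in \<open>I\<close> solved;
    this multiple also solves row \<open>x\<close>.\<close>
  define t where "t = (b x - A v' x) / A w x"
  have "\<forall>i\<in>insert x I. A (\<lambda>j. v' j + t * w j) i = b i"
    unfolding A_add_scale using \<open>A w x \<noteq> 0\<close> by (auto simp: w_orth v_sol t_def)
  then show ?case
    unfolding A_def by (rule exI[where x = "\<lambda>j. v' j + t * w j"])
qed

subsection \<open>Multinomials\<close>

lemma multisets_eq_multisets_of_size: "multisets n K = multisets_of_size {..<n} K"
  by (simp add: multisets_def multisets_of_size_def)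

lemma finite_multisets [simp]: "finite (multisets n K)"
  by (simp add: multisets_eq_multisets_of_size finite_multisets_of_size)

lemma mset_fact_pos: "mset_fact n \<phi> > 0"
  by (simp add: mset_fact_def prod_pos)

text \<open>The formula of \<open>multinomial_fun\<close> without the restriction to the simplex, so
  that it can be evaluated at rescaled points and treated as a polynomial.\<close>

definition multinomial_poly :: "nat \<Rightarrow> nat \<Rightarrow> nat multiset \<Rightarrow> (nat \<Rightarrow> real) \<Rightarrow> real" where
  "multinomial_poly n K \<phi> r = fact K / mset_fact n \<phi> * (\<Prod>i<n. r i ^ count \<phi> i)"

lemma multinomial_fun_eq: "r \<in> std_simplex n \<Longrightarrow> multinomial_fun n K \<phi> r = multinomial_poly n K \<phi> r"
  by (simp add: multinomial_fun_def multinomial_poly_def)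

text \<open>The multinomial theorem, by induction on the number of variables: a multiset on
  \<open>{..<Suc n}\<close> consists of \<open>m\<close> copies of \<open>n\<close> and a multiset
  of size \<open>K - m\<close> on \<open>{..<n}\<close>, and the sum over \<open>m\<close> is the
  binomial theorem.\<close>

lemma sum_multinomial_poly:
  "(\<Sum>\<phi>\<in>multisets n K. multinomial_poly n K \<phi> r) = (\<Sum>i<n. r i) ^ K"
proof (induction n arbitrary: K)
  case 0
  \<comment> \<open>Without indices the empty multiset is the sole candidate: for
    \<open>K = 0\<close> its value 1 matches \<open>0 ^ 0 = 1\<close>, and for positive
    \<open>K\<close> both sides are 0.\<close>
  show ?case
    by (cases "K = 0") (auto simp: multisets_eq_multisets_of_size multinomial_poly_def mset_fact_def)
next
  case (Suc n)
  have step: "multinomial_poly (Suc n) K (X + replicate_mset m n) r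
      = real (K choose m) * r n ^ m * multinomial_poly n (K - m) X r"
    if "m \<le> K" "X \<in> multisets n (K - m)" for m X
  proof -
    have "n \<notin># X" using that by (auto simp: multisets_def)
    then have [simp]: "count X n = 0" by (simp add: not_in_iff)
    have "real (K choose m) = fact K / (fact m * fact (K - m))"
      using that by (simp add: binomial_fact)
    then show ?thesis
      by (simp add: multinomial_poly_def mset_fact_def field_simps)
  qed
  have bij: "bij_betw (\<lambda>(m, X). X + replicate_mset m n)
      (SIGMA m:{0..K}. multisets n (K - m)) (multisets (Suc n) K)"
    using bij_betw_multisets_of_size_insert[of n "{..<n}" K]
    by (simp add: multisets_eq_multisets_of_size lessThan_Suc)
  have "(\<Sum>\<phi>\<in>multisets (Suc n) K. multinomial_poly (Suc n) K \<phi> r)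
      = (\<Sum>(m, X)\<in>(SIGMA m:{0..K}. multisets n (K - m)).
           multinomial_poly (Suc n) K (X + replicate_mset m n) r)"
    using sum.reindex_bij_betw[OF bij, of "\<lambda>\<phi>. multinomial_poly (Suc n) K \<phi> r"]
    by (simp add: case_prod_unfold)
  also have "\<dots> = (\<Sum>m=0..K. \<Sum>X\<in>multisets n (K - m).
      multinomial_poly (Suc n) K (X + replicate_mset m n) r)"
    by (subst sum.Sigma) auto
  also have "\<dots> = (\<Sum>m=0..K. real (K choose m) * r n ^ m * (\<Sum>i<n. r i) ^ (K - m))"
    by (simp add: step flip: Suc.IH sum_distrib_left)
  also have "\<dots> = (\<Sum>i<Suc n. r i) ^ K"
    by (simp add: binomial_ring atLeast0AtMost add.commute)
  finally show ?case .
qed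

text \<open>The multiplicities in \<open>\<phi>\<close> sum to \<open>K\<close>, so the monomial is
  homogeneous of degree \<open>K\<close>. This relates points off the simplex to their rescalings on
  it.\<close>

lemma multinomial_poly_scale:
  assumes "\<phi> \<in> multisets n K"
  shows "multinomial_poly n K \<phi> (\<lambda>i. a * r i) = a ^ K * multinomial_poly n K \<phi> r"
proof -
  have "set_mset \<phi> \<subseteq> {..<n}" "size \<phi> = K" using assms by (auto simp: multisets_def)
  then have "(\<Sum>i<n. count \<phi> i) = K"
    by (metis finite_lessThan size_multiset_overloaded_eq sum.mono_neutral_left not_in_iff DiffD2)
  then show ?thesis
    by (simp add: multinomial_poly_def power_mult_distrib prod.distrib flip: power_sum)
qed

lemma multinomial_poly_bounds:
  assumes "r \<in> std_simplex n"
  shows "0 \<le> multinomial_poly n K \<phi> r" and "multinomial_poly n K \<phi> r \<le> fact K / mset_fact n \<phi>"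
proof -
  have nonneg: "0 \<le> r i" if "i < n" for i
    using assms that by (auto simp: std_simplex_def PiE_def Pi_def)
  moreover have "r i \<le> 1" if "i < n" for i
  proof -
    have "r i \<le> (\<Sum>i<n. r i)"
      using that nonneg by (intro member_le_sum) auto
    then show ?thesis using assms by (simp add: std_simplex_def)
  qed
  ultimately have "0 \<le> (\<Prod>i<n. r i ^ count \<phi> i)" "(\<Prod>i<n. r i ^ count \<phi> i) \<le> 1"
    by (auto intro!: prod_nonneg prod_le_1 power_le_one)
  then show "0 \<le> multinomial_poly n K \<phi> r" "multinomial_poly n K \<phi> r \<le> fact K / mset_fact n \<phi>"
    using mset_fact_pos[of n \<phi>] by (auto simp: multinomial_poly_def divide_simps)
qed

subsection \<open>Linear independence\<close>

lemma sum_digits_less: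
  fixes a :: "nat \<Rightarrow> nat"
  assumes "\<And>i. i < n \<Longrightarrow> a i < B"
  shows "(\<Sum>i<n. a i * B ^ i) < B ^ n"
  using assms
proof (induction n)
  case (Suc n)
  have "(\<Sum>i<n. a i * B ^ i) < B ^ n" using Suc by simp
  moreover have "Suc (a n) * B ^ n \<le> B * B ^ n"
    using Suc.prems[of n] by (intro mult_right_mono) auto
  ultimately show ?case by simp
qed simp

text \<open>Uniqueness of base \<open>B\<close> expansions: the lower digits sum to less than
  \<open>B ^ n\<close>, so division by \<open>B ^ n\<close> isolates the top digit, and induction
  handles the rest.\<close>

lemma digits_unique:
  fixes a b :: "nat \<Rightarrow> nat"
  assumes "\<And>i. i < n \<Longrightarrow> a i < B" "\<And>i. i < n \<Longrightarrow> b i < B"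
    and "(\<Sum>i<n. a i * B ^ i) = (\<Sum>i<n. b i * B ^ i)"
    and "i < n"
  shows "a i = b i"
  using assms
proof (induction n)
  case (Suc n)
  have less: "(\<Sum>i<n. a i * B ^ i) < B ^ n" "(\<Sum>i<n. b i * B ^ i) < B ^ n"
    using Suc.prems by (auto intro!: sum_digits_less)
  have eq: "(\<Sum>i<n. a i * B ^ i) + a n * B ^ n = (\<Sum>i<n. b i * B ^ i) + b n * B ^ n"
    using Suc.prems by simp
  have "B ^ n \<noteq> 0" using less(1) by linarith
  with arg_cong[OF eq, of "\<lambda>k. k div B ^ n"] less have top: "a n = b n"
    by (simp del: power_eq_0_iff)
  show ?case
    using Suc top eq by (cases "i = n") auto
qed simp

text \<open>Vanishing is assumed just where all coordinates are positive, which is what the later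
  continuity argument supplies; the curve in the proof stays in that region.\<close>

lemma multinomial_poly_independent:
  assumes n: "n \<ge> 1"
    and vanish: "\<And>r. r \<in> std_simplex n \<Longrightarrow> (\<And>i. i < n \<Longrightarrow> 0 < r i) \<Longrightarrow>
      (\<Sum>\<phi>\<in>multisets n K. c \<phi> * multinomial_poly n K \<phi> r) = 0"
    and \<phi>: "\<phi> \<in> multisets n K"
  shows "c \<phi> = 0"
proof -
  \<comment> \<open>Along the curve \<open>r\<^sub>i = t ^ (B ^ i)\<close>, rescaled into the simplex, distinct multinomials
    become distinct powers of \<open>t\<close>.\<close>
  define B where "B = Suc K"
  define e where "e \<phi> = (\<Sum>i<n. count \<phi> i * B ^ i)" for \<phi>
  define p :: "real poly" where
    "p = (\<Sum>\<phi>\<in>multisets n K. monom (c \<phi> * (fact K / mset_fact n \<phi>)) (e \<phi>))"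
  \<comment> \<open>Multiplicities are at most \<open>K\<close>, hence digits in base
    \<open>B\<close>, and \<open>e\<close> reads a multiset as a number with these digits.\<close>
  have inj: "\<phi> = \<xi>" if "\<phi> \<in> multisets n K" "\<xi> \<in> multisets n K" "e \<phi> = e \<xi>" for \<phi> \<xi>
  proof (rule multiset_eqI)
    fix i
    have less: "count \<eta> j < B" if "\<eta> \<in> multisets n K" for \<eta> j
      using that count_le_size[of \<eta> j] by (auto simp: multisets_def B_def)
    show "count \<phi> i = count \<xi> i"
    proof (cases "i < n")
      case True
      then show ?thesis
        using digits_unique[of n "count \<phi>" B "count \<xi>" i] less that by (simp add: e_def)
    next
      case False
      then have "i \<notin># \<phi>" "i \<notin># \<xi>" using that by (auto simp: multisets_def)
      then show ?thesis by (simp add: not_in_iff)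
    qed
  qed
  have poly_p: "poly p t = (\<Sum>\<phi>\<in>multisets n K. c \<phi> * multinomial_poly n K \<phi> (\<lambda>i. t ^ (B ^ i)))" for t
    by (simp add: p_def poly_sum poly_monom multinomial_poly_def e_def power_sum mult_ac
        flip: power_mult)
  have "poly p t = 0" if "t > 0" for t
  proof -
    \<comment> \<open>Dividing by the coordinate sum \<open>S\<close> puts the point of the curve on
      the simplex; by homogeneity this changes the combination by the nonzero factor
      \<open>inverse S ^ K\<close>.\<close>
    define S where "S = (\<Sum>i<n. t ^ (B ^ i))"
    have "S > 0" unfolding S_def using n that by (intro sum_pos) (auto simp: lessThan_empty_iff)
    define r where "r = (\<lambda>i\<in>{..<n}. inverse S * t ^ (B ^ i))"
    have "(\<Sum>i<n. r i) = 1"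
      using \<open>S > 0\<close> by (simp add: r_def flip: sum_distrib_left S_def)
    then have "r \<in> std_simplex n"
      using that \<open>S > 0\<close> by (auto simp: std_simplex_def r_def)
    moreover have "0 < r i" if "i < n" for i
      using that \<open>t > 0\<close> \<open>S > 0\<close> by (simp add: r_def)
    ultimately have "(\<Sum>\<phi>\<in>multisets n K. c \<phi> * multinomial_poly n K \<phi> r) = 0"
      by (rule vanish)
    moreover have "multinomial_poly n K \<phi> r
        = inverse S ^ K * multinomial_poly n K \<phi> (\<lambda>i. t ^ (B ^ i))"
      if "\<phi> \<in> multisets n K" for \<phi>
      using multinomial_poly_scale[OF that, of "inverse S" "\<lambda>i. t ^ (B ^ i)"]
      by (simp add: multinomial_poly_def r_def)
    ultimately have "inverse S ^ K * poly p t = 0"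
      by (simp add: poly_p sum_distrib_left mult.left_commute)
    then show ?thesis using \<open>S > 0\<close> by simp
  qed
  then have "{0<..} \<subseteq> {t. poly p t = 0}" by auto
  moreover have "infinite {0::real<..}"
    by (rule infinite_Ioi)
  ultimately have "p = 0"
    using poly_roots_finite finite_subset by blast
  then have "0 = coeff p (e \<phi>)" by simp
  \<comment> \<open>By injectivity of \<open>e\<close>, no other multiset contributes to this
    coefficient.\<close>
  also have "\<dots> = (\<Sum>\<xi>\<in>multisets n K. if \<xi> = \<phi> then c \<phi> * (fact K / mset_fact n \<phi>) else 0)"
    unfolding p_def coeff_sum coeff_monom using inj \<phi> by (intro sum.cong) auto
  also have "\<dots> = c \<phi> * (fact K / mset_fact n \<phi>)"
    using \<phi> by simp
  finally show ?thesis
    using mset_fact_pos[of n \<phi>] by simp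
qed

subsection \<open>Integration over the simplex\<close>

interpretation lborel_product: product_sigma_finite "\<lambda>_::nat. lborel :: real measure"
  by standard

text \<open>In chart coordinates the simplex lies in the unit cube, which has measure 1.\<close>

lemma emeasure_std_simplex_finite: "emeasure (hyperplane_measure n) (std_simplex n) < \<infinity>"
proof -
  let ?P = "Pi\<^sub>M {..<n - 1} (\<lambda>_. lborel :: real measure)"
  have "emeasure (hyperplane_measure n) (std_simplex n)
      = emeasure ?P (last_coord_chart n -` std_simplex n \<inter> space ?P)"
    using std_simplex_sets[of n] last_coord_chart_measurable[of n]
    by (simp add: hyperplane_measure_def emeasure_distr)
  also have "\<dots> \<le> emeasure ?P (Pi\<^sub>E {..<n - 1} (\<lambda>_. {0..1}))"
  proof (rule emeasure_mono)
    show "last_coord_chart n -` std_simplex n \<inter> space ?P \<subseteq> Pi\<^sub>E {..<n - 1} (\<lambda>_. {0..1})"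
    proof (clarsimp simp: space_PiM PiE_iff)
      fix s i
      assume s: "last_coord_chart n s \<in> std_simplex n" and i: "i < n - Suc 0"
      define r where "r = last_coord_chart n s"
      have r: "r \<in> std_simplex n" using s by (simp add: r_def)
      have "r i = s i" using i by (auto simp: r_def last_coord_chart_def)
      moreover have "0 \<le> r i"
        using r i by (auto simp: std_simplex_def PiE_def Pi_def)
      moreover have "r i \<le> (\<Sum>i<n. r i)"
        using i r by (intro member_le_sum) (auto simp: std_simplex_def PiE_def Pi_def)
      moreover have "(\<Sum>i<n. r i) = 1"
        using r by (simp add: std_simplex_def)
      ultimately show "0 \<le> s i \<and> s i \<le> 1" by simp
    qed
    show "Pi\<^sub>E {..<n - 1} (\<lambda>_. {0..1}) \<in> sets ?P"
      by (intro sets_PiM_I_finite) auto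
  qed
  also have "\<dots> = 1"
    by (subst lborel_product.emeasure_PiM) auto
  finally show ?thesis
    by (simp add: less_top order_le_less_trans)
qed

lemma measurable_multinomial_poly [measurable]:
  "multinomial_poly n K \<phi> \<in> borel_measurable (hyperplane_measure n)"
  unfolding multinomial_poly_def hyperplane_measure_def by measurable

text \<open>A measurable function that is bounded on a set of finite measure is integrable
  there.\<close>

lemma set_integrable_multinomial_poly_mult:
  "set_integrable (hyperplane_measure n) (std_simplex n)
     (\<lambda>r. multinomial_poly n K \<phi> r * multinomial_poly n L \<xi> r)"
  unfolding set_integrable_def
proof (rule integrableI_bounded_set_indicator[OF std_simplex_sets _ emeasure_std_simplex_finite])
  show "AE r in hyperplane_measure n. r \<in> std_simplex n \<longrightarrow>
      norm (multinomial_poly n K \<phi> r * multinomial_poly n L \<xi> r)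
      \<le> fact K / mset_fact n \<phi> * (fact L / mset_fact n \<xi>)"
    using mset_fact_pos[of n \<phi>]
    by (intro AE_I2 impI, unfold real_norm_def abs_mult, intro mult_mono)
       (simp_all add: multinomial_poly_bounds)
qed measurable

lemma simplex_integral_cong:
  "(\<And>r. r \<in> std_simplex n \<Longrightarrow> f r = g r) \<Longrightarrow> simplex_integral n f = simplex_integral n g"
  unfolding simplex_integral_def by (intro set_lebesgue_integral_cong std_simplex_sets) auto

lemma
  assumes "\<And>i. i \<in> I \<Longrightarrow> set_integrable (hyperplane_measure n) (std_simplex n) (f i)"
  shows set_integrable_lincomb:
      "set_integrable (hyperplane_measure n) (std_simplex n) (\<lambda>r. \<Sum>i\<in>I. c i * f i r)"
    and simplex_integral_lincomb:
      "simplex_integral n (\<lambda>r. \<Sum>i\<in>I. c i * f i r) = (\<Sum>i\<in>I. c i * simplex_integral n (f i))"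
proof -
  let ?M = "hyperplane_measure n" and ?S = "std_simplex n"
  have int: "integrable ?M (\<lambda>r. c i * (indicator ?S r *\<^sub>R f i r))" if "i \<in> I" for i
    using assms[OF that] by (simp add: set_integrable_def)
  have eq: "indicator ?S r *\<^sub>R (\<Sum>i\<in>I. c i * f i r)
      = (\<Sum>i\<in>I. c i * (indicator ?S r *\<^sub>R f i r))" for r
    by (simp add: sum_distrib_left mult.left_commute)
  show "set_integrable ?M ?S (\<lambda>r. \<Sum>i\<in>I. c i * f i r)"
    unfolding set_integrable_def eq using int by (rule Bochner_Integration.integrable_sum)
  show "simplex_integral n (\<lambda>r. \<Sum>i\<in>I. c i * f i r) = (\<Sum>i\<in>I. c i * simplex_integral n (f i))"
    unfolding simplex_integral_def set_lebesgue_integral_def eq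
    by (subst Bochner_Integration.integral_sum[OF int]) auto
qed

text \<open>An open set around \<open>s\<^sub>0\<close> contains a box of positive measure, so it
  cannot miss a property that holds almost everywhere. Openness refers to all functions on the
  naturals, whereas the measure lives on extensional ones.\<close>

lemma AE_PiM_lborel_open_nonempty:
  fixes U :: "(nat \<Rightarrow> real) set"
  assumes "AE s in Pi\<^sub>M {..<m} (\<lambda>_. lborel). P s"
    and U: "open U" "s\<^sub>0 \<in> U" "s\<^sub>0 \<in> extensional {..<m}"
  shows "\<exists>s\<in>U. P s"
proof (rule ccontr)
  assume contra: "\<not> (\<exists>s\<in>U. P s)"
  let ?M = "Pi\<^sub>M {..<m} (\<lambda>_. lborel :: real measure)"
  have "openin (product_topology (\<lambda>_. euclidean) UNIV) U"
    using U(1) by (simp add: euclidean_product_topology)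
  from product_topology_open_contains_basis[OF this U(2)]
  obtain V where V: "s\<^sub>0 \<in> Pi\<^sub>E UNIV V" "\<And>i. open (V i)" "Pi\<^sub>E UNIV V \<subseteq> U"
    by (metis open_openin)
  have "Pi\<^sub>E {..<m} V \<subseteq> U"
  proof
    fix s assume s: "s \<in> Pi\<^sub>E {..<m} V"
    \<comment> \<open>Outside \<open>{..<m}\<close> both \<open>s\<close> and
      \<open>s\<^sub>0\<close> take the value \<open>undefined\<close>, so \<open>s\<close> inherits
      membership from \<open>s\<^sub>0\<close>.\<close>
    have "s i \<in> V i" for i
    proof (cases "i < m")
      case True
      then show ?thesis
        using PiE_mem[OF s] by simp
    next
      case False
      then have "s i = s\<^sub>0 i"
        using PiE_arb[OF s] extensional_arb[OF U(3)] by simp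
      then show ?thesis
        using PiE_mem[OF V(1)] by simp
    qed
    then have "s \<in> Pi\<^sub>E UNIV V" by (simp add: PiE_iff)
    then show "s \<in> U" using V(3) by (rule subsetD[rotated])
  qed
  then have "\<not> P s" if "s \<in> Pi\<^sub>E {..<m} V" for s
    using contra that by blast
  then have "AE s in ?M. s \<notin> Pi\<^sub>E {..<m} V"
    using assms(1) by (auto elim!: eventually_mono)
  moreover have "Pi\<^sub>E {..<m} V \<in> sets ?M"
    using V(2) by (intro sets_PiM_I_finite) auto
  ultimately have "emeasure ?M (Pi\<^sub>E {..<m} V) = 0"
    by (simp add: null_setsD1 flip: AE_iff_null_sets)
  \<comment> \<open>A null box has a side of measure 0, but each side contains an interval around a
    coordinate of \<open>s\<^sub>0\<close>. For \<open>m = 0\<close> the empty product is 1, already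
    a contradiction.\<close>
  then have "(\<Prod>i<m. emeasure lborel (V i)) = 0"
    using V(2) by (simp add: lborel_product.emeasure_PiM)
  then obtain i where "emeasure lborel (V i) = 0"
    by auto
  moreover have "s\<^sub>0 i \<in> V i"
    using V(1) by auto
  then obtain e where e: "0 < e" "ball (s\<^sub>0 i) e \<subseteq> V i"
    by (rule openE[OF V(2)])
  then have "emeasure lborel (ball (s\<^sub>0 i) e) \<le> emeasure lborel (V i)"
    using V(2) by (intro emeasure_mono) auto
  ultimately show False
    using e(1) by (simp add: ball_eq_greaterThanLessThan ennreal_eq_0_iff)
qed

section \<open>The chart on the simplex\<close>

lemma last_coord_chart_of_simplex:
  assumes "r \<in> std_simplex n"
  shows "last_coord_chart n (restrict r {..<n - 1}) = r"
proof
  fix i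
  show "last_coord_chart n (restrict r {..<n - 1}) i = r i"
  proof (cases "i < n")
    case True
    then obtain m where m: "n = Suc m" by (cases n) auto
    have "(\<Sum>j<m. r j) + r m = 1" using assms m by (simp add: std_simplex_def)
    then show ?thesis
      using True m by (cases "i = m") (auto simp: last_coord_chart_def)
  next
    case False
    moreover have "r \<in> {..<n} \<rightarrow>\<^sub>E {0..}"
      using assms by (simp add: std_simplex_def)
    ultimately show ?thesis
      using PiE_arb[of r "{..<n}" _ i] by (simp add: last_coord_chart_def)
  qed
qed

lemma last_coord_chart_in_simplex:
  assumes "n \<ge> 1" "\<And>i. i < n - 1 \<Longrightarrow> 0 \<le> s i" "(\<Sum>i<n - 1. s i) \<le> 1"
  shows "last_coord_chart n s \<in> std_simplex n"
proof -
  obtain m where m: "n = Suc m" using assms(1) by (cases n) auto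
  have "(\<Sum>i<n. last_coord_chart n s i) = (\<Sum>i<m. s i) + (1 - (\<Sum>i<m. s i))"
    by (simp add: m last_coord_chart_def)
  then have "(\<Sum>i<n. last_coord_chart n s i) = 1"
    by simp
  moreover have "last_coord_chart n s \<in> {..<n} \<rightarrow>\<^sub>E {0..}"
    using assms by (auto simp: last_coord_chart_def)
  ultimately show ?thesis
    by (simp add: std_simplex_def)
qed

text \<open>Coordinatewise continuity suffices for polynomials in the chart; beyond
  \<open>{..<n}\<close> the coordinate is the constant \<open>undefined\<close>.\<close>

lemma continuous_on_last_coord_chart: "continuous_on UNIV (\<lambda>s. last_coord_chart n s i)"
proof -
  have "continuous_on UNIV (\<lambda>s::nat \<Rightarrow> real. 1 - (\<Sum>j<n - 1. s j))"
    by (intro continuous_on_diff continuous_on_const continuous_on_sum) simp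
  then show ?thesis
    by (cases "i < n"; cases "i < n - 1") (simp_all add: last_coord_chart_def)
qed

section \<open>Positive definiteness of the inner product\<close>

lemma simplex_integral_square:
  "simplex_integral n (\<lambda>r. (\<Sum>\<phi>\<in>multisets n K. c \<phi> * multinomial_poly n K \<phi> r)\<^sup>2)
     = (\<Sum>\<phi>\<in>multisets n K. \<Sum>\<xi>\<in>multisets n K. c \<phi> * c \<xi> *
         simplex_integral n (\<lambda>r. multinomial_poly n K \<phi> r * multinomial_poly n K \<xi> r))" (is ?integral)
  and set_integrable_square:
  "set_integrable (hyperplane_measure n) (std_simplex n)
     (\<lambda>r. (\<Sum>\<phi>\<in>multisets n K. c \<phi> * multinomial_poly n K \<phi> r)\<^sup>2)" (is ?integrable)
proof -
  \<comment> \<open>Expanded over pairs of multisets, the square is a linear combination of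
    integrable products, so its integral is the quadratic form of the Gram matrix.\<close>
  have square: "(\<Sum>\<phi>\<in>multisets n K. c \<phi> * multinomial_poly n K \<phi> r)\<^sup>2
      = (\<Sum>z\<in>multisets n K \<times> multisets n K. (c (fst z) * c (snd z)) *
          (multinomial_poly n K (fst z) r * multinomial_poly n K (snd z) r))" for r
    by (simp add: power2_eq_square sum_product sum.cartesian_product case_prod_unfold mult_ac)
  show ?integrable
    unfolding square by (rule set_integrable_lincomb) (rule set_integrable_multinomial_poly_mult)
  show ?integral
    unfolding square
    by (subst simplex_integral_lincomb[OF set_integrable_multinomial_poly_mult])
       (simp add: sum.cartesian_product case_prod_unfold)
qed

lemma simplex_integral_square_eq_0:
  assumes n: "n \<ge> 1"
    and int: "simplex_integral n (\<lambda>r. (\<Sum>\<phi>\<in>multisets n K. c \<phi> * multinomial_poly n K \<phi> r)\<^sup>2) = 0"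
    and \<phi>: "\<phi> \<in> multisets n K"
  shows "c \<phi> = 0"
proof -
  define f where "f r = (\<Sum>\<phi>\<in>multisets n K. c \<phi> * multinomial_poly n K \<phi> r)" for r
  let ?M = "hyperplane_measure n" and ?S = "std_simplex n"
  let ?P = "Pi\<^sub>M {..<n - 1} (\<lambda>_. lborel :: real measure)"
  have "integrable ?M (\<lambda>r. indicator ?S r *\<^sub>R (f r)\<^sup>2)"
    using set_integrable_square[of n c K] by (simp add: set_integrable_def f_def)
  moreover have "(\<integral>r. indicator ?S r *\<^sub>R (f r)\<^sup>2 \<partial>?M) = 0"
    using int by (simp add: f_def simplex_integral_def set_lebesgue_integral_def)
  ultimately have "AE r in ?M. indicator ?S r *\<^sub>R (f r)\<^sup>2 = 0"
    by (subst (asm) integral_nonneg_eq_0_iff_AE) auto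
  then have "AE r in ?M. r \<in> ?S \<longrightarrow> f r = 0"
    by (auto elim!: eventually_mono)
  \<comment> \<open>Pulling back along the chart turns the statement into one about Lebesgue measure
    on \<open>n - 1\<close> coordinates, where open sets can be tested.\<close>
  then have ae: "AE s in ?P. last_coord_chart n s \<in> ?S \<longrightarrow> f (last_coord_chart n s) = 0"
    unfolding hyperplane_measure_def by (rule AE_distrD[OF last_coord_chart_measurable])
  have cont: "continuous_on UNIV (\<lambda>s. f (last_coord_chart n s))"
    unfolding f_def multinomial_poly_def
    by (intro continuous_intros continuous_on_last_coord_chart)
  have "f r = 0" if r: "r \<in> ?S" and pos: "\<And>i. i < n \<Longrightarrow> 0 < r i" for r
  proof (rule ccontr)
    assume "f r \<noteq> 0"
    let ?s = "restrict r {..<n - 1}"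
    \<comment> \<open>The strict inequalities make \<open>U\<close> open and ensure that the chart
      maps it into the simplex; the coordinates of \<open>r\<close> satisfy them because its last
      entry is positive too.\<close>
    define U where "U = {s. (\<forall>i\<in>{..<n - 1}. 0 < s i) \<and> (\<Sum>i<n - 1. s i) < 1 \<and>
      f (last_coord_chart n s) \<noteq> 0}"
    have "open {s. \<forall>i\<in>{..<n - 1}. 0 < (s i :: real)}"
      unfolding Collect_ball_eq by (intro open_INT ballI open_Collect_less) simp_all
    then have "open U"
      unfolding U_def
      by (intro open_Collect_conj open_Collect_less open_Collect_neq continuous_on_const cont
          continuous_on_sum) simp_all
    moreover have "?s \<in> U"
    proof -
      have "(\<Sum>i<Suc (n - 1). r i) = 1"
        using r n by (simp add: std_simplex_def)
      moreover have "0 < r (n - 1)"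
        using pos n by simp
      ultimately have "(\<Sum>i<n - 1. r i) < 1"
        by simp
      then show ?thesis
        using pos \<open>f r \<noteq> 0\<close> by (simp add: U_def last_coord_chart_of_simplex[OF r, simplified])
    qed
    ultimately obtain s where s: "s \<in> U"
        "last_coord_chart n s \<in> ?S \<longrightarrow> f (last_coord_chart n s) = 0"
      using AE_PiM_lborel_open_nonempty[OF ae, of U ?s] by auto
    moreover have "last_coord_chart n s \<in> ?S"
      using s(1) n by (intro last_coord_chart_in_simplex) (auto simp: U_def intro: less_imp_le)
    ultimately show False by (simp add: U_def)
  qed
  then show ?thesis
    using multinomial_poly_independent[OF n _ \<phi>, of c] by (simp add: f_def)
qed

subsection \<open>The dual basis\<close>

theorem proposition10:
  fixes n K :: nat and \<psi> :: "nat multiset"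
  assumes "n \<ge> 1" and "\<psi> \<in> multisets n K"
  shows "dual_multinomial n K \<psi> \<in> multinomial_space n K \<and>
         signed_density n (dual_multinomial n K \<psi>)"
proof -
  let ?A = "multisets n K" and ?S = "std_simplex n" and ?M = "hyperplane_measure n"
  let ?m = "multinomial_poly n K"
  \<comment> \<open>\<open>G\<close> is the Gram matrix, and \<open>D c\<close> is the function with
    coefficient vector \<open>c\<close>; duality thus becomes a linear system for \<open>c\<close>
    with matrix \<open>G\<close>.\<close>
  define G where "G \<phi> \<xi> = simplex_integral n (\<lambda>r. ?m \<phi> r * ?m \<xi> r)" for \<phi> \<xi>
  define D where "D c = (\<lambda>r\<in>?S. \<Sum>\<phi>\<in>?A. c \<phi> * multinomial_fun n K \<phi> r)" for c
  have space: "multinomial_space n K = range D"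
    by (simp add: multinomial_space_def D_def)
  have aniso: "\<forall>\<phi>\<in>?A. c \<phi> = 0" if "(\<Sum>\<phi>\<in>?A. \<Sum>\<xi>\<in>?A. c \<phi> * c \<xi> * G \<phi> \<xi>) = 0" for c
    using simplex_integral_square_eq_0[OF assms(1), of c K] that
    by (simp add: simplex_integral_square G_def)
  have D_eq: "D c r = (\<Sum>\<xi>\<in>?A. c \<xi> * ?m \<xi> r)" if "r \<in> ?S" for c r
    using that by (simp add: D_def multinomial_fun_eq)
  have mult_D: "multinomial_fun n K \<phi> r * D c r = (\<Sum>\<xi>\<in>?A. c \<xi> * (?m \<phi> r * ?m \<xi> r))"
    if "r \<in> ?S" for \<phi> c r
    using that by (simp add: multinomial_fun_eq D_eq sum_distrib_left mult.left_commute)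
  have inner: "simplex_inner n (multinomial_fun n K \<phi>) (D c) = (\<Sum>\<xi>\<in>?A. G \<phi> \<xi> * c \<xi>)" for \<phi> c
    unfolding simplex_inner_def
    by (subst simplex_integral_cong[OF mult_D], assumption)
       (simp add: simplex_integral_lincomb[OF set_integrable_multinomial_poly_mult] G_def mult.commute)
  have integrable: "set_integrable ?M ?S (\<lambda>r. multinomial_fun n K \<phi> r * D c r)" for \<phi> c
    by (subst set_integrable_cong[OF refl refl mult_D], assumption)
       (intro set_integrable_lincomb set_integrable_multinomial_poly_mult)
  have "\<exists>d. \<forall>\<phi>\<in>?A. (\<Sum>\<xi>\<in>?A. G \<phi> \<xi> * d \<xi>) = (if \<phi> = \<psi> then 1 else 0)"
    by (rule anisotropic_system_solvable[OF finite_multisets]) (rule aniso)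
  then obtain d where d: "\<forall>\<phi>\<in>?A. (\<Sum>\<xi>\<in>?A. G \<phi> \<xi> * d \<xi>) = (if \<phi> = \<psi> then 1 else 0)"
    by blast
  have dual: "dual_multinomial n K \<psi> = D d"
    unfolding dual_multinomial_def
  proof (rule the_equality)
    show "D d \<in> multinomial_space n K \<and>
        (\<forall>\<phi>\<in>?A. simplex_inner n (multinomial_fun n K \<phi>) (D d) = (if \<phi> = \<psi> then 1 else 0))"
      using d by (simp add: inner space)
  next
    fix g
    assume g: "g \<in> multinomial_space n K \<and>
        (\<forall>\<phi>\<in>?A. simplex_inner n (multinomial_fun n K \<phi>) g = (if \<phi> = \<psi> then 1 else 0))"
    then obtain c where c: "g = D c" by (auto simp: space)
    \<comment> \<open>Uniqueness: the difference of two coefficient vectors is killed by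
      \<open>G\<close>, so its quadratic form is 0 and anisotropy makes it vanish.\<close>
    have "(\<Sum>\<xi>\<in>?A. G \<phi> \<xi> * (c \<xi> - d \<xi>)) = 0" if "\<phi> \<in> ?A" for \<phi>
      using g d that by (simp add: c inner right_diff_distrib sum_subtractf)
    then have "(\<Sum>\<phi>\<in>?A. (c \<phi> - d \<phi>) * (\<Sum>\<xi>\<in>?A. G \<phi> \<xi> * (c \<xi> - d \<xi>))) = 0"
      by simp
    then have "\<forall>\<phi>\<in>?A. c \<phi> - d \<phi> = 0"
      by (intro aniso) (simp only: sum_distrib_left mult_ac)
    then show "g = D d"
      by (simp add: c D_def cong: restrict_cong)
  qed
  \<comment> \<open>On the simplex the multinomials sum to 1, so multiplying by their sum leaves
    \<open>D d\<close> unchanged. The factor 1 gives the shape of the linear-combination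
    lemmas.\<close>
  have sum_eq: "D d r = (\<Sum>\<phi>\<in>?A. 1 * (multinomial_fun n K \<phi> r * D d r))" if "r \<in> ?S" for r
    using that sum_multinomial_poly[of n K r]
    by (simp add: multinomial_fun_eq std_simplex_def flip: sum_distrib_right)
  have "set_integrable ?M ?S (D d)"
    by (subst set_integrable_cong[OF refl refl sum_eq], assumption)
       (intro set_integrable_lincomb integrable)
  moreover have "simplex_integral n (D d) = (\<Sum>\<phi>\<in>?A. 1 * simplex_inner n (multinomial_fun n K \<phi>) (D d))"
    unfolding simplex_inner_def
    by (subst simplex_integral_cong[OF sum_eq], assumption)
       (intro simplex_integral_lincomb integrable)
  \<comment> \<open>The inner products are 1 at \<open>\<psi>\<close> and 0 elsewhere, and
    \<open>\<psi>\<close> is among the summation indices.\<close>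
  then have "simplex_integral n (D d) = 1"
    using d assms(2) by (simp add: inner)
  ultimately show ?thesis
    by (simp add: dual signed_density_def space)
qed

end
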